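(* Let $G$ be a connected graph with radius $r\geq 1$, let $u$ be a center of $G$ (a vertex of eccentricity $r$), and let $D^{r}=\{u\}$. Then $G$ has sets $D^{r-1},D^{r-2},\dots,D^{1}$, where each $D^{i}$ is a connected $i$-step dominating set of $G$, satisfying $$D^{r}\subseteq D^{r-1}\subseteq \cdots\subseteq D^{1}\subseteq D^{0}=V(G),$$ and $$rc(G)\leq \sum_{i=1}^{r}\max\{2i+1,b_i\},$$ where, for $1\leq i\leq r$, $b_i$ is the number of bridges of $G$ lying in $E(D^{i},N(D^{i}))$.
   Context: All graphs are simple, finite and undirected. For an edge-coloring of a graph $H$ (adjacent edges may receive the same color), $H$ is rainbow connected if every pair of distinct vertices is joined by a path whose edges have pairwise distinct colors; the rainbow connection number $rc(H)$ is the minimum number of colors needed. The eccentricity of $v$ is $\max_{x\in V(G)}d_G(v,x)$ and the radius is the minimum eccentricity. For $S\subseteq V(G)$, $N(S)=\{v\in V(G): d_G(v,S)=1\}$. $S$ is a $k$-step dominating set if every vertex of $G$ is at distance at most $k$ from $S$; it is connected if $G[S]$ is connected. $E(X,Y)$ is the set of edges with one end in $X$ and the other in $Y$. A bridge of $G$ is an edge whose deletion disconnects $G$. *)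

theory Defs
  imports Main "HOL-Library.Extended_Nat"
begin

record 'a ugraph =
  verts :: "'a set"
  edges :: "'a set set"

definition simple_graph :: "'a ugraph \<Rightarrow> bool" where
  "simple_graph G \<longleftrightarrow> finite (verts G) \<and> (\<forall>e\<in>edges G. e \<subseteq> verts G \<and> card e = 2)"

fun path_edges :: "'a list \<Rightarrow> 'a set list" where
  "path_edges [] = []"
| "path_edges [x] = []"
| "path_edges (x # y # zs) = {x, y} # path_edges (y # zs)"

definition is_path :: "'a ugraph \<Rightarrow> 'a \<Rightarrow> 'a list \<Rightarrow> 'a \<Rightarrow> bool" where
  "is_path G x p y \<longleftrightarrow> p \<noteq> [] \<and> hd p = x \<and> last p = y \<and> distinct p \<and>
     set p \<subseteq> verts G \<and> set (path_edges p) \<subseteq> edges G"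

definition connected_graph :: "'a ugraph \<Rightarrow> bool" where
  "connected_graph G \<longleftrightarrow> verts G \<noteq> {} \<and> (\<forall>x\<in>verts G. \<forall>y\<in>verts G. \<exists>p. is_path G x p y)"

text \<open>Distances, eccentricities, the radius and the rainbow connection number take values in
  the extended naturals, so that an infimum over the empty set is infinite.\<close>

definition graph_dist :: "'a ugraph \<Rightarrow> 'a \<Rightarrow> 'a \<Rightarrow> enat" where
  "graph_dist G x y = (INF p \<in> {p. is_path G x p y}. enat (length (path_edges p)))"

definition dist_to_set :: "'a ugraph \<Rightarrow> 'a \<Rightarrow> 'a set \<Rightarrow> enat" where
  "dist_to_set G v S = (INF s\<in>S. graph_dist G v s)"

definition eccentricity :: "'a ugraph \<Rightarrow> 'a \<Rightarrow> enat" where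
  "eccentricity G v = (SUP x\<in>verts G. graph_dist G v x)"

definition radius :: "'a ugraph \<Rightarrow> enat" where
  "radius G = (INF v\<in>verts G. eccentricity G v)"

definition center :: "'a ugraph \<Rightarrow> 'a \<Rightarrow> bool" where
  "center G u \<longleftrightarrow> u \<in> verts G \<and> eccentricity G u = radius G"

definition nbhd :: "'a ugraph \<Rightarrow> 'a set \<Rightarrow> 'a set" where
  "nbhd G S = {v \<in> verts G. dist_to_set G v S = 1}"

definition induced_subgraph :: "'a ugraph \<Rightarrow> 'a set \<Rightarrow> 'a ugraph" where
  "induced_subgraph G S = \<lparr>verts = S, edges = {e \<in> edges G. e \<subseteq> S}\<rparr>"

definition step_dominating :: "'a ugraph \<Rightarrow> nat \<Rightarrow> 'a set \<Rightarrow> bool" where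
  "step_dominating G k S \<longleftrightarrow> S \<subseteq> verts G \<and> (\<forall>v\<in>verts G. dist_to_set G v S \<le> enat k)"

definition connected_step_dominating :: "'a ugraph \<Rightarrow> nat \<Rightarrow> 'a set \<Rightarrow> bool" where
  "connected_step_dominating G k S \<longleftrightarrow>
     step_dominating G k S \<and> connected_graph (induced_subgraph G S)"

definition edges_between :: "'a ugraph \<Rightarrow> 'a set \<Rightarrow> 'a set \<Rightarrow> 'a set set" where
  "edges_between G X Y = {e \<in> edges G. \<exists>x\<in>X. \<exists>y\<in>Y. e = {x, y}}"

definition delete_edge :: "'a ugraph \<Rightarrow> 'a set \<Rightarrow> 'a ugraph" where
  "delete_edge G e = \<lparr>verts = verts G, edges = edges G - {e}\<rparr>"

text \<open>Intended for connected \<open>G\<close>, where failing to be connected after the deletion means that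
  the deletion disconnects \<open>G\<close>.\<close>

definition bridge :: "'a ugraph \<Rightarrow> 'a set \<Rightarrow> bool" where
  "bridge G e \<longleftrightarrow> e \<in> edges G \<and> \<not> connected_graph (delete_edge G e)"

definition rainbow_connected :: "'a ugraph \<Rightarrow> ('a set \<Rightarrow> nat) \<Rightarrow> bool" where
  "rainbow_connected G c \<longleftrightarrow>
     (\<forall>x\<in>verts G. \<forall>y\<in>verts G. x \<noteq> y \<longrightarrow>
        (\<exists>p. is_path G x p y \<and> distinct (map c (path_edges p))))"

definition rc :: "'a ugraph \<Rightarrow> enat" where
  "rc G = (INF k \<in> {k. \<exists>c. c ` edges G \<subseteq> {..<k} \<and> rainbow_connected G c}. enat k)"

end

theory Submission
  imports Defs
begin

text \<open>Let \<open>D\<close> be a connected \<open>k\<close>-step dominating set. A shortest \<open>D\<close>-ear through a given non-bridge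
  leaving \<open>D\<close> has at most \<open>2k + 1\<close> edges. Adding such ears one after the other, with colours that
  increase along each ear, gives each added vertex two routes to \<open>D\<close>, one coloured below and one
  above a threshold. A neighbour of \<open>D\<close> that no ear reaches is attached by a bridge, and all
  these bridges get different colours. The result is a connected \<open>(k - 1)\<close>-step dominating set
  whose rainbow colouring uses \<open>max (2k + 1) b\<^sub>k\<close> new colours, and iterating from the center
  reaches \<open>V(G)\<close>.\<close>

subsection \<open>Walks\<close>

text \<open>With adjacency as a relation, \<open>adj E ^^ n\<close> is the existence of a walk of
  length exactly \<open>n\<close>; vertices may repeat.\<close>

definition adj :: "'a set set \<Rightarrow> ('a \<times> 'a) set" where
  "adj E = {(a, b). {a, b} \<in> E}"

text \<open>A walk with pairwise distinct edge colours, where the set index is exactly the set of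
  colours used. Recording that set reduces concatenation to a disjointness condition.\<close>

inductive rainbow :: "'a set set \<Rightarrow> ('a set \<Rightarrow> nat) \<Rightarrow> 'a \<Rightarrow> nat set \<Rightarrow> 'a \<Rightarrow> bool"
  for E c where
  refl: "rainbow E c a {} a"
| step: "{a, b} \<in> E \<Longrightarrow> c {a, b} \<notin> C \<Longrightarrow> rainbow E c b C z
    \<Longrightarrow> rainbow E c a (insert (c {a, b}) C) z"

lemma adj_iff: "(a, b) \<in> adj E \<longleftrightarrow> {a, b} \<in> E"
  by (simp add: adj_def)

lemma relpow_adj_sym:
  assumes "(a, b) \<in> adj E ^^ n"
  shows "(b, a) \<in> adj E ^^ n"
  using assms
proof (induction n arbitrary: b)
  case (Suc n)
  then obtain z where "(a, z) \<in> adj E ^^ n" "(z, b) \<in> adj E" by auto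
  with Suc.IH have "(z, a) \<in> adj E ^^ n" "(b, z) \<in> adj E" by (auto simp: adj_iff insert_commute)
  then show ?case by (blast intro: relpow_Suc_I2)
qed simp

lemma relpow_adj_mono:
  assumes "E \<subseteq> E'" "(a, b) \<in> adj E ^^ n"
  shows "(a, b) \<in> adj E' ^^ n"
  using assms(2)
proof (induction n arbitrary: b)
  case (Suc n)
  then obtain z where "(a, z) \<in> adj E ^^ n" "(z, b) \<in> adj E" by auto
  with Suc.IH assms(1) have "(a, z) \<in> adj E' ^^ n" "(z, b) \<in> adj E'" by (auto simp: adj_iff)
  then show ?case by auto
qed simp

text \<open>Cut the walk just before its first use of \<open>{x, y}\<close>: the part before avoids
  that edge and ends in \<open>x\<close> or in \<open>y\<close>.\<close>

lemma relpow_adj_delete: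
  assumes "(a, b) \<in> adj E ^^ n"
  shows "(a, b) \<in> adj (E - {{x, y}}) ^^ n \<or>
    (\<exists>s<n. (a, x) \<in> adj (E - {{x, y}}) ^^ s \<or> (a, y) \<in> adj (E - {{x, y}}) ^^ s)"
  using assms
proof (induction n arbitrary: b)
  case (Suc n)
  then obtain z where z: "(a, z) \<in> adj E ^^ n" "{z, b} \<in> E" by (auto simp: adj_iff)
  show ?case
  proof (cases "(a, z) \<in> adj (E - {{x, y}}) ^^ n")
    case True
    show ?thesis
    proof (cases "{z, b} = {x, y}")
      case True
      then have "z = x \<or> z = y" by (auto simp: doubleton_eq_iff)
      with \<open>(a, z) \<in> adj (E - {{x, y}}) ^^ n\<close> show ?thesis by blast
    next
      case False
      then have "(z, b) \<in> adj (E - {{x, y}})" using z by (simp add: adj_iff)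
      with True show ?thesis by auto
    qed
  next
    case False
    with Suc.IH[OF z(1)] show ?thesis using less_SucI by blast
  qed
qed simp

lemma rainbow_mono:
  assumes "rainbow E c a C b" "E \<subseteq> E'" "\<And>e. e \<in> E \<Longrightarrow> c' e = c e"
  shows "rainbow E' c' a C b"
  using assms(1)
proof induction
  case (step a b C z)
  then show ?case
    using rainbow.step[of a b E' c' C z] assms(2,3) by auto
qed (rule rainbow.refl)

text \<open>Injectivity is asked only on the colours of the walk, because the reversal
  \<open>m - 1 - i\<close> truncates at zero and is injective only below \<open>m\<close>.\<close>

lemma rainbow_recolour:
  assumes "rainbow E c a C b" "inj_on f C" "\<And>e. e \<in> E \<Longrightarrow> c' e = f (c e)"
  shows "rainbow E c' a (f ` C) b"
  using assms(1,2)
proof induction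
  case (step a b C z)
  then have "rainbow E c' b (f ` C) z" "f (c {a, b}) \<notin> f ` C" by auto
  then show ?case
    using rainbow.step[of a b E c' "f ` C" z] step.hyps(1) assms(3) by simp
qed (simp add: rainbow.refl)

lemma rainbow_append:
  assumes "rainbow E c x C y" "rainbow E c y C' z" "C \<inter> C' = {}"
  shows "rainbow E c x (C \<union> C') z"
  using assms
proof induction
  case (step a b C y)
  then show ?case using rainbow.step[of a b E c "C \<union> C'" z] by simp
qed simp

lemma rainbow_edge:
  assumes "{a, b} \<in> E"
  shows "rainbow E c a {c {a, b}} b"
  using rainbow.step[OF assms _ rainbow.refl] by simp

lemma rainbow_rev:
  assumes "rainbow E c a C b"
  shows "rainbow E c b C a"
  using assms
proof induction
  case (step a b C z)
  have "rainbow E c b {c {a, b}} a"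
    using rainbow_edge[of b a E c] step.hyps(1) by (simp add: insert_commute)
  from rainbow_append[OF step.IH this] step.hyps(2) show ?case by (simp add: insert_commute)
qed (rule rainbow.refl)

lemma rainbow_colours:
  assumes "rainbow E c a C b"
  shows "C \<subseteq> c ` E"
  using assms by induction auto

section \<open>Shortcutting walks to paths\<close>

lemma path_edges_append:
  "\<exists>zs. path_edges (xs @ a # ys) = zs @ path_edges (a # ys)"
proof (induction xs)
  case (Cons x xs)
  then obtain zs where zs: "path_edges (xs @ a # ys) = zs @ path_edges (a # ys)" ..
  obtain b bs where b: "xs @ a # ys = b # bs" by (cases xs) auto
  have "path_edges ((x # xs) @ a # ys) = ({x, b} # zs) @ path_edges (a # ys)"
    using zs b by simp
  then show ?case ..
qed simp

text \<open>If \<open>a\<close> already lies on \<open>p\<close>, keep only the part of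
  \<open>p\<close> from \<open>a\<close> on; otherwise prepend \<open>a\<close>. The new edge list
  is an extension by one edge or a suffix, so bounds on length and distinctness of colours carry
  over.\<close>

lemma is_path_Cons:
  assumes "is_path H b p z" "{a, b} \<in> edges H" "a \<in> verts H"
  obtains p' where "is_path H a p' z"
    "path_edges p' = {a, b} # path_edges p \<or> (\<exists>zs. path_edges p = zs @ path_edges p')"
proof (cases "a \<in> set p")
  case True
  then obtain xs ys where p: "p = xs @ a # ys" by (meson split_list)
  obtain zs where zs: "path_edges p = zs @ path_edges (a # ys)"
    using path_edges_append p by metis
  have "is_path H a (a # ys) z"
    using assms(1) p zs unfolding is_path_def by auto
  then show ?thesis using that zs by blast
next
  case False
  obtain q where p: "p = b # q" using assms(1) unfolding is_path_def by (cases p) auto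
  have "is_path H a (a # p) z"
    using assms False p unfolding is_path_def by auto
  then show ?thesis using that p by simp
qed

text \<open>The inclusion in \<open>C\<close> is what carries the induction: it keeps the colour of
  a prepended edge off the path found so far.\<close>

lemma rainbow_imp_path:
  assumes "rainbow (edges H) c a C b" "\<And>e. e \<in> edges H \<Longrightarrow> e \<subseteq> verts H" "b \<in> verts H"
  shows "\<exists>p. is_path H a p b \<and> distinct (map c (path_edges p)) \<and> c ` set (path_edges p) \<subseteq> C"
  using assms(1,3)
proof induction
  case (refl a)
  then show ?case by (intro exI[of _ "[a]"]) (simp add: is_path_def)
next
  case (step a b C z)
  then obtain p where p: "is_path H b p z" "distinct (map c (path_edges p))"
    "c ` set (path_edges p) \<subseteq> C" by blast
  have "a \<in> verts H" using assms(2)[OF step.hyps(1)] by simp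
  from is_path_Cons[OF p(1) step.hyps(1) this] obtain p' where p': "is_path H a p' z"
    "path_edges p' = {a, b} # path_edges p \<or> (\<exists>zs. path_edges p = zs @ path_edges p')" .
  from p'(2) have "distinct (map c (path_edges p')) \<and>
    c ` set (path_edges p') \<subseteq> insert (c {a, b}) C"
    using p(2,3) step.hyps(2) by (elim disjE exE) (auto simp: image_subset_iff)
  with p'(1) show ?case by blast
qed

lemma relpow_imp_path:
  assumes "(a, b) \<in> adj (edges H) ^^ n" "\<And>e. e \<in> edges H \<Longrightarrow> e \<subseteq> verts H" "b \<in> verts H"
  shows "\<exists>p. is_path H a p b \<and> length (path_edges p) \<le> n"
  using assms(1)
proof (induction n arbitrary: a)
  case 0
  then show ?case using assms(3) by (intro exI[of _ "[a]"]) (simp add: is_path_def)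
next
  case (Suc n)
  then obtain z where z: "(a, z) \<in> adj (edges H)" "(z, b) \<in> adj (edges H) ^^ n"
    by (meson relpow_Suc_E2)
  then obtain p where p: "is_path H z p b" "length (path_edges p) \<le> n" using Suc.IH by blast
  have e: "{a, z} \<in> edges H" using z by (simp add: adj_iff)
  have "a \<in> verts H" using assms(2)[OF e] by simp
  from is_path_Cons[OF p(1) e this] obtain p' where p': "is_path H a p' b"
    "path_edges p' = {a, z} # path_edges p \<or> (\<exists>zs. path_edges p = zs @ path_edges p')" .
  from p'(2) have "length (path_edges p') \<le> Suc n" using p(2) by auto
  with p'(1) show ?case by blast
qed

lemma path_imp_relpow:
  assumes "is_path H a p b"
  shows "(a, b) \<in> adj (edges H) ^^ length (path_edges p)"
proof -
  have "p \<noteq> [] \<Longrightarrow> set (path_edges p) \<subseteq> edges H \<Longrightarrow>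
    (hd p, last p) \<in> adj (edges H) ^^ length (path_edges p)"
  proof (induction p rule: path_edges.induct)
    case (3 x y zs)
    then have "(y, last (y # zs)) \<in> adj (edges H) ^^ length (path_edges (y # zs))"
      "(x, y) \<in> adj (edges H)" by (auto simp: adj_iff)
    from relpow_Suc_I2[OF this(2,1)] show ?case by simp
  qed auto
  then show ?thesis using assms by (auto simp: is_path_def)
qed

section \<open>Distances and neighbourhoods in terms of walks\<close>

lemma graph_dist_le_imp_relpow:
  assumes "graph_dist G x y \<le> enat n"
  shows "\<exists>j\<le>n. (x, y) \<in> adj (edges G) ^^ j"
proof -
  \<comment> \<open>A strict bound on an infimum yields a member below it, hence an actual
    path.\<close>
  have "graph_dist G x y < enat (Suc n)" using assms by (simp add: order.strict_trans1)
  then obtain p where "is_path G x p y" "length (path_edges p) < Suc n"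
    unfolding graph_dist_def INF_less_iff by auto
  then show ?thesis using path_imp_relpow by (metis less_Suc_eq_le)
qed

lemma dist_to_set_le:
  assumes "simple_graph G" "D \<subseteq> verts G" "b \<in> D" "(v, b) \<in> adj (edges G) ^^ n"
  shows "dist_to_set G v D \<le> enat n"
proof -
  have "\<exists>p. is_path G v p b \<and> length (path_edges p) \<le> n"
    using assms by (intro relpow_imp_path) (auto simp: simple_graph_def)
  then obtain p where p: "is_path G v p b" "length (path_edges p) \<le> n" by blast
  have "dist_to_set G v D \<le> graph_dist G v b"
    unfolding dist_to_set_def using assms(3) by (rule INF_lower)
  also have "\<dots> \<le> enat (length (path_edges p))"
    unfolding graph_dist_def using p by (intro INF_lower) simp
  also have "\<dots> \<le> enat n" using p by simp
  finally show ?thesis .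
qed

lemma in_nbhdI:
  assumes "simple_graph G" "D \<subseteq> verts G" "x \<in> D" "{x, y} \<in> edges G" "y \<notin> D"
  shows "y \<in> nbhd G D"
proof -
  have "(y, x) \<in> adj (edges G) ^^ 1" using assms(4) by (simp add: adj_iff insert_commute)
  from dist_to_set_le[OF assms(1-3) this] have 1: "dist_to_set G y D \<le> 1"
    by (simp add: one_enat_def)
  have "\<not> dist_to_set G y D < 1"
  proof
    assume "dist_to_set G y D < 1"
    then obtain s p where "s \<in> D" "is_path G y p s" "enat (length (path_edges p)) < 1"
      unfolding dist_to_set_def graph_dist_def INF_less_iff by auto
    with path_imp_relpow[of G y p s] have "y = s"
      by (simp add: one_enat_def)
    with \<open>s \<in> D\<close> assms(5) show False by simp
  qed
  with 1 have "dist_to_set G y D = 1" by simp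
  moreover have "y \<in> verts G" using assms(1,4) by (auto simp: simple_graph_def)
  ultimately show ?thesis by (simp add: nbhd_def)
qed

subsection \<open>Adding ears\<close>

text \<open>The least number is arbitrary when no walk leads to \<open>D\<close>, so the facts about
  it are stated for vertices that have such a walk.\<close>

definition set_dist :: "'a set set \<Rightarrow> 'a set \<Rightarrow> 'a \<Rightarrow> nat" where
  "set_dist E D x = (LEAST n. \<exists>b\<in>D. (x, b) \<in> adj E ^^ n)"

text \<open>These edges get their colours from the ears, while edges inside \<open>D\<close> keep
  the colours they have.\<close>

definition new_edges :: "'a set set \<Rightarrow> 'a set \<Rightarrow> 'a set \<Rightarrow> 'a set set" where
  "new_edges E D M = {e \<in> E. e \<subseteq> M \<and> \<not> e \<subseteq> D}"

text \<open>The threshold \<open>t x\<close> separates the colours of two routes from \<open>x\<close> to \<open>D\<close>. For two vertices,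
  the lower route of the one with the smaller threshold and the upper route of the other share no
  colour. The distance condition leaves enough colours on one side of \<open>t x\<close> for a further ear that
  ends in \<open>x\<close>.\<close>

definition ear_colouring ::
  "'a set set \<Rightarrow> 'a set \<Rightarrow> nat \<Rightarrow> 'a set \<Rightarrow> ('a set \<Rightarrow> nat) \<Rightarrow> ('a \<Rightarrow> nat) \<Rightarrow> bool" where
  "ear_colouring E D m M g t \<longleftrightarrow> D \<subseteq> M \<and> (\<forall>e. g e < m) \<and>
     (\<forall>x\<in>M - D. t x \<le> m \<and> (t x \<le> set_dist E D x \<or> m - t x \<le> set_dist E D x) \<and>
        (\<exists>a\<in>D. \<exists>A\<subseteq>{..<t x}. rainbow (new_edges E D M) g x A a) \<and>
        (\<exists>b\<in>D. \<exists>B\<subseteq>{t x..<m}. rainbow (new_edges E D M) g x B b))"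

lemma set_dist_le: "b \<in> D \<Longrightarrow> (x, b) \<in> adj E ^^ n \<Longrightarrow> set_dist E D x \<le> n"
  unfolding set_dist_def by (rule Least_le) blast

lemma set_dist_attained:
  assumes "b \<in> D" "(x, b) \<in> adj E ^^ n"
  shows "\<exists>a\<in>D. (x, a) \<in> adj E ^^ set_dist E D x"
  unfolding set_dist_def using assms by (intro LeastI_ex[of "\<lambda>n. \<exists>b\<in>D. (x, b) \<in> adj E ^^ n"]) blast

text \<open>Reversing the order of the colours turns lower routes into upper ones and swaps the two
  alternatives of the distance condition. This allows a choice of direction when an ear is
  attached.\<close>

lemma ear_colouring_mirror:
  assumes "ear_colouring E D m M g t"
  shows "ear_colouring E D m M (\<lambda>e. m - 1 - g e) (\<lambda>x. m - t x)"
proof -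
  let ?f = "\<lambda>i. m - 1 - i"
  have rec: "rainbow (new_edges E D M) (\<lambda>e. m - 1 - g e) x (?f ` C) a"
    if "rainbow (new_edges E D M) g x C a" "C \<subseteq> {..<m}" for x C a
  proof (rule rainbow_recolour[OF that(1)])
    show "inj_on ?f C"
    proof (rule inj_onI)
      fix i j assume "i \<in> C" "j \<in> C" "?f i = ?f j"
      moreover from this have "i < m" "j < m" using that(2) by auto
      ultimately show "i = j" by simp
    qed
  qed simp
  have "m - t x \<le> m \<and> (m - t x \<le> set_dist E D x \<or> m - (m - t x) \<le> set_dist E D x) \<and>
        (\<exists>a\<in>D. \<exists>A\<subseteq>{..<m - t x}. rainbow (new_edges E D M) (\<lambda>e. m - 1 - g e) x A a) \<and>
        (\<exists>b\<in>D. \<exists>B\<subseteq>{m - t x..<m}. rainbow (new_edges E D M) (\<lambda>e. m - 1 - g e) x B b)"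
    if x: "x \<in> M - D" for x
  proof -
    obtain a A b B where *: "t x \<le> m" "t x \<le> set_dist E D x \<or> m - t x \<le> set_dist E D x"
      "a \<in> D" "A \<subseteq> {..<t x}" "rainbow (new_edges E D M) g x A a"
      "b \<in> D" "B \<subseteq> {t x..<m}" "rainbow (new_edges E D M) g x B b"
      using bspec[OF conjunct2[OF conjunct2[OF assms[unfolded ear_colouring_def]]] x]
      by (elim conjE bexE exE) blast
    have A: "A \<subseteq> {..<m}" "B \<subseteq> {..<m}" using * by auto
    have "?f ` B \<subseteq> {..<m - t x}"
    proof
      fix i assume "i \<in> ?f ` B"
      then obtain j where "j \<in> B" "i = m - 1 - j" by auto
      moreover from this *(7) have "t x \<le> j" "j < m" by auto
      ultimately show "i \<in> {..<m - t x}" by auto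
    qed
    moreover have "?f ` A \<subseteq> {m - t x..<m}"
    proof
      fix i assume "i \<in> ?f ` A"
      then obtain j where "j \<in> A" "i = m - 1 - j" by auto
      moreover from this *(4) have "j < t x" by auto
      ultimately show "i \<in> {m - t x..<m}" using *(1) by auto
    qed
    moreover have "m - t x \<le> set_dist E D x \<or> m - (m - t x) \<le> set_dist E D x"
      using *(1,2) by auto
    ultimately show ?thesis using *(3,6) rec[OF *(5) A(1)] rec[OF *(8) A(2)]
      by (intro conjI bexI[of _ b] bexI[of _ a] exI[of _ "?f ` A"] exI[of _ "?f ` B"]) auto
  qed
  moreover have "m - 1 - g e < m" for e
  proof -
    have "g e < m" using assms by (simp add: ear_colouring_def)
    then show ?thesis by simp
  qed
  moreover have "D \<subseteq> M" using assms by (simp add: ear_colouring_def)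
  ultimately show ?thesis by (simp add: ear_colouring_def)
qed

text \<open>Take a shortest walk from \<open>w i\<close> to \<open>D\<close>. If it avoids the edge
  \<open>{x, w 0}\<close>, minimality of the ear makes its length \<open>n - i\<close>. Otherwise
  cut it before that edge. A part ending in \<open>x\<close> would have length at least
  \<open>n - i\<close>, which is too long. A part ending in \<open>w 0\<close> has length at least
  \<open>i\<close>, since the ear could be shortened by a smaller one, and the deleted edge adds one
  more.\<close>

lemma shortest_ear_dist:
  assumes x: "x \<in> D"
    and w: "\<And>i. i < n \<Longrightarrow> (w i, w (Suc i)) \<in> adj (E - {{x, w 0}})" "w n \<in> D"
    and shortest: "\<And>b j. b \<in> D \<Longrightarrow> (w 0, b) \<in> adj (E - {{x, w 0}}) ^^ j \<Longrightarrow> n \<le> j"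
    and i: "i \<le> n"
  shows "Suc i \<le> set_dist E D (w i) \<or> set_dist E D (w i) = n - i"
proof -
  let ?E = "E - {{x, w 0}}"
  have seg: "(w i, w (i + j)) \<in> adj ?E ^^ j" if "i + j \<le> n" for i j
    using that
  proof (induction j)
    case (Suc j)
    then show ?case using w(1)[of "i + j"] by auto
  qed simp
  have pre: "(w 0, w i) \<in> adj ?E ^^ i" using seg[of 0 i] i by simp
  have post: "(w i, w n) \<in> adj ?E ^^ (n - i)" using seg[of i "n - i"] i by simp
  have "(w i, w n) \<in> adj E ^^ (n - i)" by (rule relpow_adj_mono[OF _ post]) auto
  then have le: "set_dist E D (w i) \<le> n - i" and
    "\<exists>a\<in>D. (w i, a) \<in> adj E ^^ set_dist E D (w i)"
    using w(2) by (auto intro: set_dist_le set_dist_attained)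
  then obtain a where a: "a \<in> D" "(w i, a) \<in> adj E ^^ set_dist E D (w i)" by blast
  \<comment> \<open>The first \<open>i\<close> steps of the ear followed by this walk compete with
    the whole ear.\<close>
  have ge: "n - i \<le> s" if "b \<in> D" "(w i, b) \<in> adj ?E ^^ s" for b s
    using shortest[OF that(1), of "i + s"] relpow_trans[OF pre that(2)] by simp
  from relpow_adj_delete[OF a(2), of x "w 0"]
  consider "(w i, a) \<in> adj ?E ^^ set_dist E D (w i)"
    | s where "s < set_dist E D (w i)" "(w i, x) \<in> adj ?E ^^ s"
    | s where "s < set_dist E D (w i)" "(w i, w 0) \<in> adj ?E ^^ s" by blast
  then show ?thesis
  proof cases
    case 1
    then show ?thesis using ge[OF a(1) 1] le by simp
  next
    case (2 s)
    then show ?thesis using ge[OF x 2(2)] le by simp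
  next
    case (3 s)
    have "(w 0, w n) \<in> adj ?E ^^ (s + (n - i))"
      using relpow_adj_sym[OF 3(2)] post by (rule relpow_trans)
    from shortest[OF w(2) this] i have "i \<le> s" by linarith
    with 3(1) show ?thesis by simp
  qed
qed

text \<open>The ear runs from \<open>x\<close> over \<open>w 0\<close> to \<open>w L\<close>, where
  it first meets \<open>M\<close>, and its colours increase strictly. From an inner vertex, going
  back to \<open>x\<close> uses only colours below that of the next edge; going forward to
  \<open>w L\<close> and then along the upper route of \<open>w L\<close> uses only that colour and
  larger ones. The assumption \<open>room\<close> leaves enough colours below the threshold of
  \<open>w L\<close>.\<close>

lemma ear_extend_oriented:
  assumes ec: "ear_colouring E D m M g t"
    and x: "x \<in> D" "{x, w 0} \<in> E"
    and w: "\<And>i. i < n \<Longrightarrow> (w i, w (Suc i)) \<in> adj (E - {{x, w 0}})" "w n \<in> D"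
    and shortest: "\<And>b j. b \<in> D \<Longrightarrow> (w 0, b) \<in> adj (E - {{x, w 0}}) ^^ j \<Longrightarrow> n \<le> j"
    and nm: "n < m"
    and L: "0 < L" "L \<le> n" "w L \<in> M" "\<And>i. i < L \<Longrightarrow> w i \<notin> M"
    and room: "w L \<notin> D \<Longrightarrow> m - t (w L) \<le> set_dist E D (w L)"
  shows "\<exists>g' t'. ear_colouring E D m (M \<union> w ` {..<L}) g' t'"
proof -
  let ?d = "set_dist E D"
  define M' where "M' = M \<union> w ` {..<L}"
  have DM: "D \<subseteq> M" and gm: "g e < m" for e using ec by (auto simp: ear_colouring_def)
  have dist: "Suc i \<le> ?d (w i) \<or> ?d (w i) = n - i" if "i \<le> n" for i
    by (rule shortest_ear_dist[OF x(1) w shortest that])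
  have reach: "\<exists>b\<in>D. (w i, b) \<in> adj E ^^ (n - i)" if "i \<le> n" for i
    using that
  proof (induction "n - i" arbitrary: i)
    case 0
    then show ?case using w(2) by (intro bexI[of _ "w n"]) auto
  next
    case (Suc j)
    then have i: "i < n" "n - i = Suc j" "n - Suc i = j" by auto
    with Suc.hyps(1)[of "Suc i"] obtain b where "b \<in> D" "(w (Suc i), b) \<in> adj E ^^ j" by auto
    moreover have "(w i, w (Suc i)) \<in> adj E" using w(1)[OF i(1)] by (simp add: adj_iff)
    ultimately show ?case using i(2) by (metis relpow_Suc_I2)
  qed
  have dn: "?d (w i) \<le> n - i" if "i \<le> n" for i
    using reach[OF that] set_dist_le by metis
  have dSuc: "?d (w (Suc i)) \<le> Suc (?d (w i))" if i: "i < n" for i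
  proof -
    have "i \<le> n" using i by simp
    from reach[OF this] obtain a where a: "a \<in> D" "(w i, a) \<in> adj E ^^ ?d (w i)"
      using set_dist_attained by metis
    have "(w (Suc i), w i) \<in> adj E" using w(1)[OF i] by (simp add: adj_iff insert_commute)
    from relpow_Suc_I2[OF this a(2)] show ?thesis by (rule set_dist_le[OF a(1)])
  qed
  \<comment> \<open>If the ear ends in \<open>D\<close>, nothing has to be coloured beyond
    \<open>w L\<close>, so all \<open>m\<close> colours are available.\<close>
  define T where "T = (if w L \<in> D then m else t (w L))"
  \<comment> \<open>For \<open>i < L\<close>, \<open>s i\<close> serves both as the threshold of
    \<open>w i\<close> and as the colour of the edge to \<open>w (Suc i)\<close>. The first value is
    at most the distance of \<open>w i\<close>; the second makes \<open>m - s i\<close> equal to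
    \<open>n - i\<close>, the length of the rest of the walk.\<close>
  define s where "s i = (if i < L then if Suc i \<le> ?d (w i) then Suc i else m - (n - i) else T)" for i
  have Tm: "T \<le> m" using ec L(3) by (auto simp: T_def ear_colouring_def)
  \<comment> \<open>By \<open>room\<close> and the distance bound at \<open>w L\<close>. With
    \<open>n < m\<close> this leaves at least \<open>L + 1\<close> colours below \<open>T\<close>,
    one for each edge of the ear.\<close>
  have Tge: "m - (n - L) \<le> T"
  proof (cases "w L \<in> D")
    case False
    then show ?thesis using room dn[OF L(2)] by (simp add: T_def)
  qed (simp add: T_def)
  have s0: "0 < s 0" using L(1) nm by (simp add: s_def)
  \<comment> \<open>By \<open>dSuc\<close>, once \<open>s\<close> has switched to its second formula
    it stays there. At the switch \<open>n < m\<close> gives the strict increase, and at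
    \<open>L\<close> it comes from \<open>Tge\<close>.\<close>
  have sSuc: "s i < s (Suc i)" if i: "i < L" for i
  proof (cases "Suc i < L")
    case True
    then have "i < n" using L(2) by simp
    with dSuc[OF this] True i nm show ?thesis by (auto simp: s_def)
  next
    case False
    then have "L = Suc i" using i by simp
    with Tge nm L(2) show ?thesis by (auto simp: s_def)
  qed
  have sm: "i \<le> L \<Longrightarrow> s i \<le> m" for i
  proof (induction "L - i" arbitrary: i)
    case 0
    then show ?case using Tm by (simp add: s_def)
  next
    case (Suc j)
    then have "s (Suc i) \<le> m" by simp
    moreover have "i < L" using Suc.hyps(2) by simp
    ultimately show ?case using sSuc[of i] by simp
  qed
  \<comment> \<open>Leaving out the part between two equal vertices would give a shorter
    ear.\<close>
  have winj: "i = j" if "w i = w j" "i \<le> j" "j \<le> L" for i j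
  proof (rule ccontr)
    assume "i \<noteq> j"
    with that have ij: "i < j" "j \<le> n" using L(2) by auto
    have "j < L"
    proof (rule ccontr)
      assume "\<not> j < L"
      then have "j = L" using that by simp
      with L(3) L(4)[of i] ij that(1) show False by simp
    qed
    have "(w 0, w i) \<in> adj (E - {{x, w 0}}) ^^ i"
      unfolding relpow_fun_conv using w(1) ij by (intro exI[of _ w]) auto
    moreover have "(w j, w n) \<in> adj (E - {{x, w 0}}) ^^ (n - j)"
      unfolding relpow_fun_conv using w(1) ij by (intro exI[of _ "\<lambda>k. w (j + k)"]) auto
    ultimately have "(w 0, w n) \<in> adj (E - {{x, w 0}}) ^^ (i + (n - j))"
      using that(1) by (metis relpow_trans)
    from shortest[OF w(2) this] ij show False by simp
  qed
  have winj': "i = j" if "w i = w j" "i \<le> L" "j \<le> L" for i j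
    using winj[of i j] winj[of j i] that by (cases "i \<le> j") auto
  \<comment> \<open>The description is unique because the ear repeats no vertex; \<open>0\<close> is
    reserved for the entry edge, below all \<open>s i\<close>.\<close>
  define col where "col e = (if e \<in> new_edges E D M then g e
    else if e = {x, w 0} then 0 else THE k. \<exists>i<L. e = {w i, w (Suc i)} \<and> k = s i)" for e
  have newe: "e \<notin> new_edges E D M" if "w i \<in> e" "i < L" for e i
    using that L(4)[of i] by (auto simp: new_edges_def)
  have col0: "col {x, w 0} = 0" using newe[of 0 "{x, w 0}"] L(1) by (simp add: col_def)
  have colS: "col {w i, w (Suc i)} = s i" if i: "i < L" for i
  proof -
    have "{w i, w (Suc i)} \<noteq> {x, w 0}" using w(1)[of i] i L(2) by (auto simp: adj_iff)
    moreover have "(THE k. \<exists>j<L. {w i, w (Suc i)} = {w j, w (Suc j)} \<and> k = s j) = s i"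
    proof (rule the_equality)
      fix k assume "\<exists>j<L. {w i, w (Suc i)} = {w j, w (Suc j)} \<and> k = s j"
      then obtain j where j: "j < L" "{w i, w (Suc i)} = {w j, w (Suc j)}" "k = s j" by blast
      from j(2) have "w i = w j \<or> w i = w (Suc j) \<and> w (Suc i) = w j"
        by (auto simp: doubleton_eq_iff)
      then have "i = j" using winj'[of i j] winj'[of i "Suc j"] winj'[of "Suc i" j] i j(1) by auto
      with j(3) show "k = s i" by simp
    qed (use i in blast)
    ultimately show ?thesis using newe[of i] i by (simp add: col_def)
  qed
  \<comment> \<open>Off the ear and off the old edges \<open>col\<close> is unspecified, and the cap
    ensures the bound \<open>m\<close> there as well. On the ear it changes nothing, since
    \<open>s i < s (Suc i) \<le> m\<close>.\<close>
  define g' where "g' e = min (m - 1) (col e)" for e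
  define t' where "t' v = (if v \<in> M then t v else s (THE i. i < L \<and> v = w i))" for v
  have m0: "0 < m" using nm by simp
  have g'm: "g' e < m" for e using m0 by (simp add: g'_def)
  have g'old: "g' e = g e" if "e \<in> new_edges E D M" for e
    using that gm[of e] by (simp add: g'_def col_def)
  have g'0: "g' {x, w 0} = 0" by (simp add: g'_def col0)
  have g'S: "g' {w i, w (Suc i)} = s i" if "i < L" for i
    using colS[OF that] sSuc[OF that] sm[of "Suc i"] that by (simp add: g'_def)
  have t'w: "t' (w i) = s i" if i: "i < L" for i
  proof -
    have "(THE j. j < L \<and> w i = w j) = i"
      using i winj'[of i] by (intro the_equality) auto
    then show ?thesis using L(4)[OF i] by (simp add: t'_def)
  qed
  have sub: "new_edges E D M \<subseteq> new_edges E D M'" by (auto simp: new_edges_def M'_def)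
  have e0: "{w 0, x} \<in> new_edges E D M'"
    using x L(1) L(4)[of 0] DM by (auto simp: new_edges_def M'_def insert_commute)
  have eS: "{w i, w (Suc i)} \<in> new_edges E D M'" if i: "i < L" for i
  proof -
    have "w (Suc i) \<in> M'" using i L(3) by (cases "Suc i = L") (auto simp: M'_def)
    moreover have "w i \<in> M'" "w i \<notin> D" using i L(4)[OF i] DM by (auto simp: M'_def)
    moreover have "{w i, w (Suc i)} \<in> E" using w(1)[of i] i L(2) by (auto simp: adj_iff)
    ultimately show ?thesis by (auto simp: new_edges_def)
  qed
  have low: "\<exists>A\<subseteq>{..<s i}. rainbow (new_edges E D M') g' (w i) A x" if "i < L" for i
    using that
  proof (induction i)
    case 0
    have "rainbow (new_edges E D M') g' (w 0) {0} x"
      using rainbow_edge[OF e0, of g'] g'0 by (simp add: insert_commute)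
    then show ?case using s0 by (intro exI[of _ "{0}"]) auto
  next
    case (Suc i)
    then obtain A where A: "A \<subseteq> {..<s i}" "rainbow (new_edges E D M') g' (w i) A x" by auto
    have "rainbow (new_edges E D M') g' (w (Suc i)) (insert (s i) A) x"
      using rainbow.step[of "w (Suc i)" "w i" "new_edges E D M'" g' A x] A eS[of i] g'S[of i]
        Suc.prems by (auto simp: insert_commute)
    moreover have "insert (s i) A \<subseteq> {..<s (Suc i)}"
      using A(1) sSuc[of i] Suc.prems by auto
    ultimately show ?case by blast
  qed
  have "\<exists>b\<in>D. \<exists>B\<subseteq>{T..<m}. rainbow (new_edges E D M) g (w L) B b"
  proof (cases "w L \<in> D")
    case True
    then show ?thesis
      by (intro bexI[of _ "w L"] exI[of _ "{}"]) (auto intro: rainbow.refl)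
  next
    case False
    then show ?thesis using ec L(3) by (simp add: ear_colouring_def T_def)
  qed
  then obtain b B0 where b: "b \<in> D" "B0 \<subseteq> {T..<m}" "rainbow (new_edges E D M) g (w L) B0 b"
    by blast
  have up: "\<exists>B\<subseteq>{s i..<m}. rainbow (new_edges E D M') g' (w i) B b" if "i \<le> L" for i
    using that
  proof (induction "L - i" arbitrary: i)
    case 0
    then have "i = L" by simp
    moreover have "rainbow (new_edges E D M') g' (w L) B0 b"
      by (rule rainbow_mono[OF b(3) sub]) (rule g'old)
    ultimately show ?case using b(2) by (auto simp: s_def)
  next
    case (Suc j)
    then have i: "i < L" "j = L - Suc i" "Suc i \<le> L" by auto
    from Suc.hyps(1)[OF i(2,3)] obtain B where B: "B \<subseteq> {s (Suc i)..<m}"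
      "rainbow (new_edges E D M') g' (w (Suc i)) B b" by blast
    have "s i \<notin> B" using B(1) sSuc[OF i(1)] by auto
    then have "rainbow (new_edges E D M') g' (w i) (insert (s i) B) b"
      using rainbow.step[OF eS[OF i(1)] _ B(2)] g'S[OF i(1)] by simp
    moreover have "insert (s i) B \<subseteq> {s i..<m}"
      using B(1) sSuc[OF i(1)] sm[of "Suc i"] i by fastforce
    ultimately show ?case by blast
  qed
  have "t' v \<le> m \<and> (t' v \<le> ?d v \<or> m - t' v \<le> ?d v) \<and>
        (\<exists>a\<in>D. \<exists>A\<subseteq>{..<t' v}. rainbow (new_edges E D M') g' v A a) \<and>
        (\<exists>b\<in>D. \<exists>B\<subseteq>{t' v..<m}. rainbow (new_edges E D M') g' v B b)"
    if v: "v \<in> M' - D" for v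
  proof (cases "v \<in> M")
    case True
    then have tv: "t' v = t v" by (simp add: t'_def)
    have lift: "rainbow (new_edges E D M') g' v C a" if "rainbow (new_edges E D M) g v C a" for C a
      by (rule rainbow_mono[OF that sub]) (rule g'old)
    have "t v \<le> m \<and> (t v \<le> ?d v \<or> m - t v \<le> ?d v) \<and>
        (\<exists>a\<in>D. \<exists>A\<subseteq>{..<t v}. rainbow (new_edges E D M) g v A a) \<and>
        (\<exists>b\<in>D. \<exists>B\<subseteq>{t v..<m}. rainbow (new_edges E D M) g v B b)"
      using ec True v by (simp add: ear_colouring_def)
    then show ?thesis unfolding tv using lift by blast
  next
    case False
    then obtain i where i: "i < L" "v = w i" using v by (auto simp: M'_def)
    \<comment> \<open>If the first formula applies, \<open>s i\<close> is at most the distance by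
      definition. If not, \<open>dist\<close> identifies the distance with \<open>n - i\<close>,
      which is \<open>m - s i\<close>.\<close>
    have "s i \<le> ?d (w i) \<or> m - s i \<le> ?d (w i)"
      using dist[of i] i L(2) nm by (auto simp: s_def)
    moreover have "\<exists>B\<subseteq>{s i..<m}. rainbow (new_edges E D M') g' (w i) B b" "s i \<le> m"
      using up[of i] sm[of i] i(1) by auto
    ultimately show ?thesis using i t'w[OF i(1)] low[OF i(1)] x(1) b(1) by auto
  qed
  then have "ear_colouring E D m M' g' t'"
    using DM g'm by (auto simp: ear_colouring_def M'_def)
  then show ?thesis unfolding M'_def by blast
qed

text \<open>The new ear is a shortest walk from \<open>y\<close> to \<open>D\<close> that avoids
  \<open>{x, y}\<close>, stopped at its first vertex in \<open>M\<close>.\<close>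

lemma ear_extend:
  assumes ec: "ear_colouring E D (2 * k + 1) M g t"
    and dom: "\<And>e v. e \<in> E \<Longrightarrow> v \<in> e \<Longrightarrow> \<exists>b\<in>D. \<exists>j\<le>k. (v, b) \<in> adj E ^^ j"
    and x: "x \<in> D" "{x, y} \<in> E" "y \<notin> M"
    and ear: "(y, x) \<in> adj (E - {{x, y}}) ^^ q"
  shows "\<exists>M' g' t'. ear_colouring E D (2 * k + 1) M' g' t' \<and> insert y M \<subseteq> M' \<and> M' \<subseteq> M \<union> \<Union> E"
proof -
  let ?m = "2 * k + 1"
  define n where "n = set_dist (E - {{x, y}}) D y"
  obtain a where a: "a \<in> D" "(y, a) \<in> adj (E - {{x, y}}) ^^ n"
    using set_dist_attained[OF x(1) ear] by (auto simp: n_def)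
  have shortest: "n \<le> j" if "b \<in> D" "(y, b) \<in> adj (E - {{x, y}}) ^^ j" for b j
    unfolding n_def using that by (rule set_dist_le)
  from a(2) obtain w where w0: "w 0 = y" "w n = a"
    and w: "\<And>i. i < n \<Longrightarrow> (w i, w (Suc i)) \<in> adj (E - {{x, y}})"
    unfolding relpow_fun_conv by blast
  have DM: "D \<subseteq> M" using ec by (simp add: ear_colouring_def)
  have wE: "\<exists>e\<in>E. w i \<in> e" if "i \<le> n" for i
  proof (cases "i = n")
    case True
    have "n \<noteq> 0" using w0 a(1) DM x(3) by (metis subsetD)
    then have "0 < n" by simp
    then show ?thesis using w[of "n - 1"] True by (auto simp: adj_iff)
  next
    case False
    then show ?thesis using w[of i] that by (auto simp: adj_iff)
  qed
  \<comment> \<open>Look at the middle vertex \<open>w k\<close> of a longer ear: domination puts it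
    within distance \<open>k\<close> of \<open>D\<close>, but \<open>shortest_ear_dist\<close>
    offers only at least \<open>k + 1\<close> or exactly \<open>n - k\<close>, which exceeds
    \<open>k\<close>.\<close>
  have nm: "n < ?m"
  proof (rule ccontr)
    assume "\<not> n < ?m"
    then have kn: "k \<le> n" "2 * k < n" by auto
    obtain b j where "b \<in> D" "j \<le> k" "(w k, b) \<in> adj E ^^ j"
      using wE[OF kn(1)] dom by metis
    then have "set_dist E D (w k) \<le> k" using set_dist_le by (metis le_trans)
    moreover have "Suc k \<le> set_dist E D (w k) \<or> set_dist E D (w k) = n - k"
      by (rule shortest_ear_dist[OF x(1) _ _ _ kn(1)]) (use w w0 a(1) shortest in auto)
    ultimately show False using kn by linarith
  qed
  define L where "L = (LEAST i. w i \<in> M)"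
  have wn: "w n \<in> M" using w0 a(1) DM by auto
  have L: "w L \<in> M" "L \<le> n" "\<And>i. i < L \<Longrightarrow> w i \<notin> M"
    using LeastI[of "\<lambda>i. w i \<in> M", OF wn] Least_le[of "\<lambda>i. w i \<in> M", OF wn] not_less_Least
    by (auto simp: L_def)
  have L0: "0 < L" using L(1) w0 x(3) by (cases L) auto
  \<comment> \<open>If the threshold at the endpoint satisfies the other alternative of the distance
    condition, the mirrored colouring satisfies the required one.\<close>
  have "\<exists>g t. ear_colouring E D ?m M g t \<and>
    (w L \<notin> D \<longrightarrow> ?m - t (w L) \<le> set_dist E D (w L))"
  proof (cases "w L \<notin> D \<longrightarrow> ?m - t (w L) \<le> set_dist E D (w L)")
    case True
    with ec show ?thesis by blast
  next
    case False
    then have "t (w L) \<le> ?m" "t (w L) \<le> set_dist E D (w L)"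
      using ec L(1) unfolding ear_colouring_def by auto
    then have "?m - (?m - t (w L)) \<le> set_dist E D (w L)" by simp
    with ear_colouring_mirror[OF ec] show ?thesis by blast
  qed
  then obtain g1 t1 where 1: "ear_colouring E D ?m M g1 t1"
    "w L \<notin> D \<Longrightarrow> ?m - t1 (w L) \<le> set_dist E D (w L)" by blast
  have "\<exists>g' t'. ear_colouring E D ?m (M \<union> w ` {..<L}) g' t'"
    using x w w0 a(1) shortest nm L0 L 1
    by (intro ear_extend_oriented[where n = n and x = x and g = g1 and t = t1]) auto
  then obtain g' t' where "ear_colouring E D ?m (M \<union> w ` {..<L}) g' t'" by blast
  moreover have "insert y M \<subseteq> M \<union> w ` {..<L}" using w0 L0 by auto
  moreover have "w ` {..<L} \<subseteq> \<Union> E" using wE L(2) by fastforce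
  ultimately show ?thesis by blast
qed


section \<open>Exhausting the non-bridges that leave \<open>D\<close>\<close>

lemma not_bridge_imp_walk:
  assumes "\<not> bridge G e" "e \<in> edges G" "a \<in> verts G" "b \<in> verts G"
  shows "\<exists>q. (a, b) \<in> adj (edges G - {e}) ^^ q"
proof -
  have "connected_graph (delete_edge G e)" using assms by (simp add: bridge_def)
  with assms(3,4) obtain p where "is_path (delete_edge G e) a p b"
    by (auto simp: connected_graph_def delete_edge_def)
  from path_imp_relpow[OF this] show ?thesis by (auto simp: delete_edge_def)
qed

text \<open>Choose \<open>M\<close> of largest size. A non-bridge from \<open>D\<close> to a vertex
  outside \<open>M\<close> would give a further ear and hence a larger set.\<close>

lemma ear_colouring_maximal:
  fixes G :: "'a ugraph"
  assumes G: "simple_graph G"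
    and D: "D \<subseteq> verts G"
    and dom: "\<And>v. v \<in> verts G \<Longrightarrow> \<exists>b\<in>D. \<exists>j\<le>k. (v, b) \<in> adj (edges G) ^^ j"
  shows "\<exists>M g t. ear_colouring (edges G) D (2 * k + 1) M g t \<and> M \<subseteq> verts G \<and>
    (\<forall>x\<in>D. \<forall>y. {x, y} \<in> edges G \<longrightarrow> y \<notin> M \<longrightarrow> bridge G {x, y})"
proof -
  let ?P = "\<lambda>M. M \<subseteq> verts G \<and> (\<exists>g t. ear_colouring (edges G) D (2 * k + 1) M g t)"
  have finV: "finite (verts G)" and EV: "\<And>e. e \<in> edges G \<Longrightarrow> e \<subseteq> verts G"
    using G by (auto simp: simple_graph_def)
  \<comment> \<open>The start without ears: every condition on \<open>M - D\<close> is
    vacuous.\<close>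
  have "ear_colouring (edges G) D (2 * k + 1) D (\<lambda>_. 0) (\<lambda>_. 0)"
    by (simp add: ear_colouring_def)
  with D have "?P D" by blast
  moreover have "\<forall>M. ?P M \<longrightarrow> card M < Suc (card (verts G))"
    using finV by (auto simp: less_Suc_eq_le intro: card_mono)
  ultimately obtain M where M: "?P M" "\<And>N. ?P N \<Longrightarrow> card N \<le> card M"
    using ex_has_greatest_nat[of ?P D card "Suc (card (verts G))"] by blast
  then obtain g t where ec: "ear_colouring (edges G) D (2 * k + 1) M g t" by blast
  have "bridge G {x, y}" if xy: "x \<in> D" "{x, y} \<in> edges G" "y \<notin> M" for x y
  proof (rule ccontr)
    assume "\<not> bridge G {x, y}"
    then obtain q where q: "(y, x) \<in> adj (edges G - {{x, y}}) ^^ q"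
      using not_bridge_imp_walk[of G "{x, y}" y x] EV[OF xy(2)] xy(2) by auto
    have dom': "\<exists>b\<in>D. \<exists>j\<le>k. (v, b) \<in> adj (edges G) ^^ j" if "e \<in> edges G" "v \<in> e" for e v
      using dom EV that by blast
    have "\<exists>M' g' t'. ear_colouring (edges G) D (2 * k + 1) M' g' t' \<and> insert y M \<subseteq> M' \<and>
      M' \<subseteq> M \<union> \<Union> (edges G)"
      by (rule ear_extend[OF ec _ xy q]) (rule dom')
    then obtain N g' t' where
      N: "ear_colouring (edges G) D (2 * k + 1) N g' t'" "insert y M \<subseteq> N"
      "N \<subseteq> M \<union> \<Union> (edges G)" by blast
    have "N \<subseteq> verts G" using N(3) M(1) EV by blast
    with N(1) have "card N \<le> card M" by (intro M(2)) blast
    moreover have "card M < card N"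
      using N(2) xy(3) finite_subset[OF \<open>N \<subseteq> verts G\<close> finV] by (intro psubset_card_mono) auto
    ultimately show False by simp
  qed
  with ec M(1) show ?thesis by blast
qed

subsection \<open>Shrinking the domination distance\<close>

definition inner_edges :: "'a set set \<Rightarrow> 'a set \<Rightarrow> 'a set set" where
  "inner_edges E D = {e \<in> E. e \<subseteq> D}"

text \<open>The routes stay inside \<open>D\<close>. Hence the property survives any recolouring of
  other edges, and it yields connectivity of the induced subgraph.\<close>

definition rainbow_on :: "'a set set \<Rightarrow> ('a set \<Rightarrow> nat) \<Rightarrow> 'a set \<Rightarrow> bool" where
  "rainbow_on E c D \<longleftrightarrow> (\<forall>x\<in>D. \<forall>y\<in>D. \<exists>C. rainbow (inner_edges E D) c x C y)"

text \<open>To \<open>D\<close> are added a largest ear set \<open>M\<close> and the set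
  \<open>P\<close> of neighbours left over, each attached by one bridge. Two vertices reach
  \<open>D\<close> with disjoint sets of new colours and are then joined inside \<open>D\<close> by
  old ones. Ears and bridges can share one block of new colours, since a vertex of \<open>M\<close>
  has a route on either side of its threshold and a vertex of \<open>P\<close> needs one colour
  only. Hence a maximum and not a sum.\<close>

lemma domination_step:
  fixes G :: "'a ugraph"
  defines "E \<equiv> edges G"
  assumes G: "simple_graph G"
    and D: "D \<subseteq> verts G"
    and dom: "\<And>v. v \<in> verts G \<Longrightarrow> \<exists>b\<in>D. \<exists>j\<le>Suc k. (v, b) \<in> adj E ^^ j"
    and c: "rainbow_on E c D" "c ` inner_edges E D \<subseteq> {..<K}"
  defines "N \<equiv> max (2 * Suc k + 1) (card {e \<in> edges_between G D (nbhd G D). bridge G e})"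
  shows "\<exists>D' c'. D \<subseteq> D' \<and> D' \<subseteq> verts G \<and>
    (\<forall>v\<in>verts G. \<exists>b\<in>D'. \<exists>j\<le>k. (v, b) \<in> adj E ^^ j) \<and>
    rainbow_on E c' D' \<and> c' ` inner_edges E D' \<subseteq> {..<K + N}"
proof -
  let ?m = "2 * Suc k + 1"
  define Br where "Br = {e \<in> edges_between G D (nbhd G D). bridge G e}"
  obtain M g t where ec: "ear_colouring E D ?m M g t" and MV: "M \<subseteq> verts G"
    and Mbr: "\<And>x y. x \<in> D \<Longrightarrow> {x, y} \<in> E \<Longrightarrow> y \<notin> M \<Longrightarrow> bridge G {x, y}"
    using ear_colouring_maximal[OF G D dom[unfolded E_def]] unfolding E_def by blast
  have DM: "D \<subseteq> M" and gm: "\<And>e. g e < ?m" using ec unfolding ear_colouring_def by auto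
  define P where "P = {y. y \<notin> M \<and> (\<exists>x\<in>D. {x, y} \<in> E)}"
  have "\<forall>y\<in>P. \<exists>x. x \<in> D \<and> {x, y} \<in> E" by (auto simp: P_def)
  then obtain f where f: "\<And>y. y \<in> P \<Longrightarrow> f y \<in> D \<and> {f y, y} \<in> E" by metis
  have EV: "\<And>e. e \<in> E \<Longrightarrow> e \<subseteq> verts G" and finV: "finite (verts G)"
    using G by (auto simp: simple_graph_def E_def)
  have "finite E" by (rule finite_subset[of _ "Pow (verts G)"]) (use EV finV in auto)
  then have finBr: "finite Br" unfolding Br_def edges_between_def E_def by simp
  then obtain h where h: "bij_betw h Br {0..<card Br}" using ex_bij_betw_finite_nat by blast
  have inBr: "{f y, y} \<in> Br" if "y \<in> P" for y
  proof -
    have y: "y \<notin> M" "y \<notin> D" "f y \<in> D" "{f y, y} \<in> E" using that f DM by (auto simp: P_def)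
    have "y \<in> nbhd G D" using in_nbhdI[OF G D y(3) _ y(2)] y(4) by (simp add: E_def)
    then show ?thesis using y Mbr[of "f y" y] by (auto simp: Br_def edges_between_def E_def)
  qed
  define D' where "D' = M \<union> P"
  have PV: "P \<subseteq> verts G" using EV by (auto simp: P_def)
  \<comment> \<open>Old colours lie below \<open>K\<close>, new ones start at \<open>K\<close>. The
    final \<open>K\<close> is a default that only has to lie below \<open>K + N\<close>.\<close>
  define c' where "c' e = (if e \<subseteq> D then c e else if e \<in> new_edges E D M then K + g e
     else if e \<in> Br then K + h e else K)" for e
  have "c' ` inner_edges E D' \<subseteq> {..<K + N}"
  proof -
    have "h e < card Br" if "e \<in> Br" for e using h that by (auto simp: bij_betw_def)
    then have "h e < N" if "e \<in> Br" for e
      using that less_le_trans unfolding N_def Br_def[symmetric] by (metis max.cobounded2)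
    moreover have "g e < N" for e using gm[of e] by (simp add: N_def)
    moreover have "0 < N" by (simp add: N_def)
    moreover have "c e < K" if "e \<subseteq> D" "e \<in> E" for e using c(2) that by (auto simp: inner_edges_def)
    ultimately show ?thesis by (auto simp: c'_def inner_edges_def trans_less_add1)
  qed
  \<comment> \<open>All neighbours of \<open>D\<close> lie in \<open>D'\<close>, so a walk to
    \<open>D\<close> may stop one edge earlier.\<close>
  moreover have "\<exists>b\<in>D'. \<exists>j\<le>k. (v, b) \<in> adj E ^^ j" if v: "v \<in> verts G" for v
  proof -
    obtain b j where b: "b \<in> D" "j \<le> Suc k" "(v, b) \<in> adj E ^^ j" using dom[OF v] by blast
    show ?thesis
    proof (cases j)
      case 0
      then have "v \<in> D'" using b DM by (auto simp: D'_def)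
      then show ?thesis by (intro bexI[of _ v] exI[of _ 0]) auto
    next
      case (Suc i)
      then obtain z where z: "(v, z) \<in> adj E ^^ i" "{z, b} \<in> E" using b(3) by (auto simp: adj_iff)
      then have "z \<in> D'" using b(1) by (auto simp: D'_def P_def insert_commute)
      then show ?thesis using z(1) b(2) Suc by auto
    qed
  qed
  moreover have "rainbow_on E c' D'"
  proof -
    let ?R = "rainbow (inner_edges E D') c'"
    have old: "?R x C a" if "rainbow (inner_edges E D) c x C a" for x C a
      by (rule rainbow_mono[OF that]) (use DM in \<open>auto simp: inner_edges_def D'_def c'_def\<close>)
    have new: "?R x ((+) K ` C) a" if "rainbow (new_edges E D M) g x C a" for x C a
    proof (rule rainbow_mono)
      show "rainbow (new_edges E D M) c' x ((+) K ` C) a"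
        by (rule rainbow_recolour[OF that]) (auto simp: c'_def new_edges_def)
    qed (auto simp: inner_edges_def new_edges_def D'_def)
    have br: "?R y {K + h {f y, y}} (f y)" if "y \<in> P" for y
    proof -
      have y: "y \<notin> M" "y \<notin> D" "f y \<in> D" "{f y, y} \<in> E" using that f DM by (auto simp: P_def)
      have "{y, f y} \<in> inner_edges E D'"
        using y that DM by (auto simp: inner_edges_def D'_def insert_commute)
      from rainbow_edge[OF this, of c'] show ?thesis
        using y inBr[OF that] by (simp add: c'_def new_edges_def insert_commute)
    qed
    \<comment> \<open>The sets \<open>A\<close> and \<open>B\<close> are taken before the shift by
      \<open>K\<close>, so that they can be compared directly with the thresholds and with
      \<open>h\<close>.\<close>
    define ok where "ok x y \<longleftrightarrow> (\<exists>a\<in>D. \<exists>b\<in>D. \<exists>A B. ?R x ((+) K ` A) a \<and> ?R y ((+) K ` B) b \<and> A \<inter> B = {})"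
      for x y
    have ok_sym: "ok y x" if "ok x y" for x y using that unfolding ok_def by blast
    have ecD: "(\<exists>a\<in>D. \<exists>A\<subseteq>{..<t x}. rainbow (new_edges E D M) g x A a) \<and>
        (\<exists>b\<in>D. \<exists>B\<subseteq>{t x..<?m}. rainbow (new_edges E D M) g x B b)" if "x \<in> M - D" for x
      using ec that unfolding ear_colouring_def by simp
    have route: "\<exists>a\<in>D. \<exists>A. ?R x ((+) K ` A) a" if x: "x \<in> D'" for x
    proof -
      consider "x \<in> D" | "x \<in> M - D" | "x \<in> P" using x by (auto simp: D'_def)
      then show ?thesis
      proof cases
        case 1
        have "?R x ((+) K ` {}) x" by (simp add: rainbow.refl)
        with 1 show ?thesis by blast
      next
        case 2
        then obtain a A where "a \<in> D" "rainbow (new_edges E D M) g x A a"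
          using ecD[OF 2] by blast
        with new show ?thesis by blast
      next
        case 3
        have "?R x ((+) K ` {h {f x, x}}) (f x)" using br[OF 3] by simp
        with f[OF 3] show ?thesis by blast
      qed
    qed
    have ok_D: "ok x y" if "x \<in> D" "y \<in> D'" for x y
    proof -
      have "?R x ((+) K ` {}) x" by (simp add: rainbow.refl)
      with route[OF that(2)] that(1) show ?thesis unfolding ok_def by blast
    qed
    have low: "\<exists>a\<in>D. \<exists>A\<subseteq>{..<t x}. ?R x ((+) K ` A) a" if "x \<in> M - D" for x
      using ecD[OF that] new by blast
    have up: "\<exists>a\<in>D. \<exists>A\<subseteq>{t x..<?m}. ?R x ((+) K ` A) a" if "x \<in> M - D" for x
      using ecD[OF that] new by blast
    have ok_M: "ok x y" if xy: "x \<in> M - D" "y \<in> M - D" "t x \<le> t y" for x y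
    proof -
      obtain a A b B where *: "a \<in> D" "A \<subseteq> {..<t x}" "?R x ((+) K ` A) a"
        "b \<in> D" "B \<subseteq> {t y..<?m}" "?R y ((+) K ` B) b" using low[OF xy(1)] up[OF xy(2)] by blast
      have "A \<inter> B = {}" using *(2,5) xy(3) by fastforce
      with * show ?thesis unfolding ok_def by blast
    qed
    \<comment> \<open>The bridge colour of \<open>y\<close> lies on one side of the threshold of
      \<open>x\<close>, and \<open>x\<close> takes its route on the other side.\<close>
    have ok_MP: "ok x y" if xy: "x \<in> M - D" "y \<in> P" for x y
    proof -
      let ?h = "h {f y, y}"
      have "\<exists>a\<in>D. \<exists>A. ?R x ((+) K ` A) a \<and> ?h \<notin> A"
      proof (cases "?h < t x")
        case True
        then have "?h \<notin> A" if "A \<subseteq> {t x..<?m}" for A using that by auto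
        with up[OF xy(1)] show ?thesis by blast
      next
        case False
        then have "?h \<notin> A" if "A \<subseteq> {..<t x}" for A using that by auto
        with low[OF xy(1)] show ?thesis by blast
      qed
      then obtain a A where "a \<in> D" "?R x ((+) K ` A) a" "A \<inter> {?h} = {}" by blast
      moreover have "?R y ((+) K ` {?h}) (f y)" using br[OF xy(2)] by simp
      ultimately show ?thesis using f[OF xy(2)] unfolding ok_def by blast
    qed
    have ok_P: "ok x y" if xy: "x \<in> P" "y \<in> P" "x \<noteq> y" for x y
    proof -
      have "f x \<noteq> y" using f[OF xy(1)] xy(2) DM by (auto simp: P_def)
      then have "{f x, x} \<noteq> {f y, y}" using xy(3) by (auto simp: doubleton_eq_iff)
      then have "h {f x, x} \<noteq> h {f y, y}"
        using inBr[OF xy(1)] inBr[OF xy(2)] h inj_on_eq_iff[of h Br] by (auto simp: bij_betw_def)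
      then have "{h {f x, x}} \<inter> {h {f y, y}} = {}" by simp
      moreover have "?R x ((+) K ` {h {f x, x}}) (f x)" "?R y ((+) K ` {h {f y, y}}) (f y)"
        using br xy by simp_all
      ultimately show ?thesis using f[OF xy(1)] f[OF xy(2)] unfolding ok_def by blast
    qed
    have ok: "ok x y" if xy: "x \<in> D'" "y \<in> D'" "x \<noteq> y" for x y
    proof -
      consider "x \<in> D" | "y \<in> D" | "x \<in> M - D" "y \<in> M - D" | "x \<in> M - D" "y \<in> P"
        | "x \<in> P" "y \<in> M - D" | "x \<in> P" "y \<in> P"
        using xy unfolding D'_def by blast
      then show ?thesis
      proof cases
        case 3
        then show ?thesis
          using ok_M[of x y] ok_sym[OF ok_M[of y x]] by (cases "t x \<le> t y") auto
      next
        case 1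
        then show ?thesis using xy(2) by (rule ok_D)
      next
        case 2
        then show ?thesis using xy(1) by (intro ok_sym[OF ok_D])
      next
        case 4
        then show ?thesis by (rule ok_MP)
      next
        case 5
        then show ?thesis by (intro ok_sym[OF ok_MP])
      next
        case 6
        then show ?thesis using xy(3) by (rule ok_P)
      qed
    qed
    \<comment> \<open>Leave \<open>x\<close> with colours \<open>K + A\<close>, cross
      \<open>D\<close> with colours below \<open>K\<close>, and arrive at \<open>y\<close> with
      colours \<open>K + B\<close>.\<close>
    have "\<exists>C. ?R x C y" if xy: "x \<in> D'" "y \<in> D'" for x y
    proof (cases "x = y")
      case True
      then show ?thesis using rainbow.refl[of "inner_edges E D'" c' x] by auto
    next
      case False
      from ok[OF xy this] obtain a b A B where *: "a \<in> D" "b \<in> D" "?R x ((+) K ` A) a"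
        "?R y ((+) K ` B) b" "A \<inter> B = {}" unfolding ok_def by blast
      obtain C where C: "rainbow (inner_edges E D) c a C b"
        using c(1) *(1,2) unfolding rainbow_on_def by blast
      have CK: "C \<subseteq> {..<K}" using rainbow_colours[OF C] c(2) by blast
      then have "(+) K ` A \<inter> C = {}" by auto
      from rainbow_append[OF *(3) old[OF C] this] have "?R x ((+) K ` A \<union> C) b" .
      moreover have "((+) K ` A \<union> C) \<inter> (+) K ` B = {}" using CK *(5) by auto
      ultimately have "?R x ((+) K ` A \<union> C \<union> (+) K ` B) y"
        by (rule rainbow_append[OF _ rainbow_rev[OF *(4)]])
      then show ?thesis ..
    qed
    then show ?thesis by (simp add: rainbow_on_def)
  qed
  moreover have "D \<subseteq> D'" "D' \<subseteq> verts G" using DM MV PV by (auto simp: D'_def)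
  ultimately show ?thesis by (intro exI[of _ D'] exI[of _ c']) simp
qed

section \<open>Building the chain from the center\<close>

lemma rainbow_on_imp_connected:
  assumes "rainbow_on (edges G) c D" "D \<noteq> {}"
  shows "connected_graph (induced_subgraph G D)"
  unfolding connected_graph_def
proof (intro conjI ballI)
  let ?H = "induced_subgraph G D"
  show "verts ?H \<noteq> {}" using assms(2) by (simp add: induced_subgraph_def)
  fix x y assume xy: "x \<in> verts ?H" "y \<in> verts ?H"
  then obtain C where "rainbow (edges ?H) c x C y"
    using assms(1) by (auto simp: rainbow_on_def inner_edges_def induced_subgraph_def)
  from rainbow_imp_path[OF this _ xy(2)] show "\<exists>p. is_path ?H x p y"
    by (auto simp: induced_subgraph_def)
qed

theorem theorem2:
  fixes G :: "'a ugraph" and r :: nat and u :: 'a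
  assumes "simple_graph G"
    and "connected_graph G"
    and "radius G = enat r"
    and "r \<ge> 1"
    and "center G u"
  shows "\<exists>D :: nat \<Rightarrow> 'a set.
           D r = {u} \<and> D 0 = verts G \<and>
           (\<forall>i\<in>{1..<r}. connected_step_dominating G i (D i)) \<and>
           (\<forall>i<r. D (Suc i) \<subseteq> D i) \<and>
           rc G \<le> enat (\<Sum>i=1..r. max (2 * i + 1)
                      (card {e \<in> edges_between G (D i) (nbhd G (D i)). bridge G e}))"
proof -
  let ?E = "edges G"
  define w where "w D i = max (2 * i + 1)
    (card {e \<in> edges_between G (D i) (nbhd G (D i)). bridge G e})" for D :: "nat \<Rightarrow> 'a set" and i
  \<comment> \<open>Step domination expressed by walks, the form that \<open>domination_step\<close>
    takes and returns.\<close>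
  define dom where "dom i S \<longleftrightarrow> (\<forall>v\<in>verts G. \<exists>b\<in>S. \<exists>j\<le>i. (v, b) \<in> adj ?E ^^ j)" for i S
  have u: "u \<in> verts G" "eccentricity G u = enat r" using assms(3,5) by (auto simp: center_def)
  have EV: "\<And>e. e \<in> ?E \<Longrightarrow> e \<subseteq> verts G \<and> card e = 2" using assms(1) by (auto simp: simple_graph_def)
  have domr: "dom r {u}"
    unfolding dom_def
  proof
    fix v assume "v \<in> verts G"
    then have "graph_dist G u v \<le> enat r"
      using SUP_upper[of v "verts G" "graph_dist G u"] u(2) by (simp add: eccentricity_def)
    then show "\<exists>b\<in>{u}. \<exists>j\<le>r. (v, b) \<in> adj ?E ^^ j"
      using graph_dist_le_imp_relpow relpow_adj_sym by (metis singletonI)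
  qed
  \<comment> \<open>Downward induction from \<open>r\<close> to \<open>0\<close>. Each set keeps
    some rainbow colouring and the vertex \<open>u\<close>, from which its connectivity follows
    later; the colour bound is carried only for the current set \<open>D k\<close>.\<close>
  have "\<exists>D c. D r = {u} \<and>
      (\<forall>i\<in>{k..r}. D i \<subseteq> verts G \<and> u \<in> D i \<and> dom i (D i) \<and> (\<exists>c. rainbow_on ?E c (D i))) \<and>
      (\<forall>i\<in>{k..<r}. D (Suc i) \<subseteq> D i) \<and>
      rainbow_on ?E c (D k) \<and> c ` inner_edges ?E (D k) \<subseteq> {..<\<Sum>i=Suc k..r. w D i}"
    if "k \<le> r" for k
    using that
  proof (induction k rule: inc_induct)
    case base
    \<comment> \<open>A single vertex spans no edge, so the empty sum of colours suffices.\<close>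
    have "inner_edges ?E {u} = {}"
    proof -
      have "e \<notin> inner_edges ?E {u}" for e
        using EV[of e] by (auto simp: inner_edges_def subset_singleton_iff)
      then show ?thesis by blast
    qed
    moreover have "rainbow_on ?E (\<lambda>_. 0) {u}" by (auto simp: rainbow_on_def intro: rainbow.refl)
    ultimately show ?case using domr u(1)
      by (intro exI[of _ "\<lambda>_. {u}"] exI[of _ "\<lambda>_. 0"]) auto
  next
    case (step k)
    then obtain D c where D: "D r = {u}"
      "\<And>i. i \<in> {Suc k..r} \<Longrightarrow> D i \<subseteq> verts G \<and> u \<in> D i \<and> dom i (D i) \<and> (\<exists>c. rainbow_on ?E c (D i))"
      "\<And>i. i \<in> {Suc k..<r} \<Longrightarrow> D (Suc i) \<subseteq> D i"
      "rainbow_on ?E c (D (Suc k))"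
      "c ` inner_edges ?E (D (Suc k)) \<subseteq> {..<\<Sum>i=Suc (Suc k)..r. w D i}" by auto
    have Dk: "D (Suc k) \<subseteq> verts G" "u \<in> D (Suc k)" "dom (Suc k) (D (Suc k))"
      using D(2)[of "Suc k"] step.hyps by auto
    have "\<exists>S c'. D (Suc k) \<subseteq> S \<and> S \<subseteq> verts G \<and> dom k S \<and> rainbow_on ?E c' S \<and>
      c' ` inner_edges ?E S \<subseteq> {..<(\<Sum>i=Suc (Suc k)..r. w D i) + w D (Suc k)}"
      unfolding dom_def w_def[of D "Suc k"]
      by (rule domination_step[OF assms(1) Dk(1) _ D(4,5)]) (use Dk(3) in \<open>simp add: dom_def\<close>)
    then obtain S c' where S: "D (Suc k) \<subseteq> S" "S \<subseteq> verts G" "dom k S" "rainbow_on ?E c' S"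
      "c' ` inner_edges ?E S \<subseteq> {..<(\<Sum>i=Suc (Suc k)..r. w D i) + w D (Suc k)}" by auto
    \<comment> \<open>Only the value at \<open>k\<close> changes, so the weights of all larger
      indices, and with them the sum, are the same for \<open>D'\<close> as for
      \<open>D\<close>.\<close>
    define D' where "D' = D(k := S)"
    have old: "D' i = D i" if "k < i" for i using that by (simp add: D'_def)
    have "(\<Sum>i=Suc k..r. w D' i) = (\<Sum>i=Suc k..r. w D i)"
      by (rule sum.cong) (auto simp: w_def old)
    also have "\<dots> = (\<Sum>i=Suc (Suc k)..r. w D i) + w D (Suc k)"
      using step.hyps by (simp add: sum.atLeast_Suc_atMost)
    finally have "c' ` inner_edges ?E (D' k) \<subseteq> {..<\<Sum>i=Suc k..r. w D' i}"
      using S(5) by (simp add: D'_def)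
    moreover have "rainbow_on ?E c' (D' k)" using S(4) by (simp add: D'_def)
    moreover have "D' r = {u}" using D(1) step.hyps by (simp add: old)
    moreover have "D' (Suc i) \<subseteq> D' i" if "i \<in> {k..<r}" for i
      using that D(3)[of i] S(1) by (cases "i = k") (auto simp: D'_def)
    moreover have "D' i \<subseteq> verts G \<and> u \<in> D' i \<and> dom i (D' i) \<and> (\<exists>c. rainbow_on ?E c (D' i))"
      if "i \<in> {k..r}" for i
    proof (cases "i = k")
      case True
      then show ?thesis using S Dk(2) by (auto simp: D'_def)
    next
      case False
      then show ?thesis using that D(2)[of i] by (auto simp: D'_def)
    qed
    ultimately show ?case by - (rule exI[of _ D'], rule exI[of _ c'], simp)
  qed
  from this[of 0] obtain D c where D: "D r = {u}"
    "\<And>i. i \<le> r \<Longrightarrow> D i \<subseteq> verts G \<and> u \<in> D i \<and> dom i (D i) \<and> (\<exists>c. rainbow_on ?E c (D i))"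
    "\<And>i. i < r \<Longrightarrow> D (Suc i) \<subseteq> D i"
    "rainbow_on ?E c (D 0)" "c ` inner_edges ?E (D 0) \<subseteq> {..<\<Sum>i=1..r. w D i}" by auto
  \<comment> \<open>Domination with walks of length zero means that every vertex belongs to
    \<open>D 0\<close>.\<close>
  have D0: "D 0 = verts G" using D(2)[of 0] by (auto simp: dom_def)
  have inner: "inner_edges ?E (D 0) = ?E" using EV D0 by (auto simp: inner_edges_def)
  have "connected_step_dominating G i (D i)" if "i \<in> {1..<r}" for i
  proof -
    have i: "D i \<subseteq> verts G" "u \<in> D i" "dom i (D i)" "\<exists>c. rainbow_on ?E c (D i)"
      using D(2)[of i] that by auto
    have "dist_to_set G v (D i) \<le> enat i" if v: "v \<in> verts G" for v
    proof -
      obtain b j where b: "b \<in> D i" "j \<le> i" "(v, b) \<in> adj ?E ^^ j"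
        using i(3) v unfolding dom_def by blast
      from dist_to_set_le[OF assms(1) i(1) b(1,3)] b(2) show ?thesis
        by (meson enat_ord_simps(1) order_trans)
    qed
    moreover have "connected_graph (induced_subgraph G (D i))"
      using i(2,4) rainbow_on_imp_connected by (metis empty_iff)
    ultimately show ?thesis using i(1)
      by (auto simp: connected_step_dominating_def step_dominating_def)
  qed
  moreover have "rc G \<le> enat (\<Sum>i=1..r. w D i)"
  proof -
    have "rainbow_connected G c"
      unfolding rainbow_connected_def
    proof (intro ballI impI)
      fix x y assume xy: "x \<in> verts G" "y \<in> verts G"
      then obtain C where "rainbow ?E c x C y" using D(4) unfolding rainbow_on_def inner unfolding D0 by blast
      from rainbow_imp_path[OF this _ xy(2)] EV
      show "\<exists>p. is_path G x p y \<and> distinct (map c (path_edges p))" by blast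
    qed
    then show ?thesis unfolding rc_def using D(5) inner by (intro INF_lower) auto
  qed
  ultimately show ?thesis using D(1,3) D0 unfolding w_def by (intro exI[of _ D]) simp
qed

end
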